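(* Let $k\in\mathbb{N}$ and write $s=\sigma+it$ with $\sigma,t\in\mathbb{R}$. (a) If $q_3 k+4\log 3\le \sigma\le q_2 k-2$, then $\zeta^{(k)}(s)\neq 0$ (for every $t\in\mathbb{R}$). (b) If $M\in\mathbb{N}$, $M\ge 3$, and $q_M k+(M+1)\log 3\le \sigma\le q_{M-1}k-M\log 3$, then $\zeta^{(k)}(s)\neq 0$ (for every $t\in\mathbb{R}$).
   Context: $\zeta^{(k)}(s)$ denotes the $k$-th derivative of the Riemann zeta function, a meromorphic function on $\mathbb{C}$ with only a pole at $s=1$, given for $\sigma>1$ by $\zeta^{(k)}(s)=(-1)^k\sum_{n\ge 2}(\log n)^k n^{-s}$. For an integer $M\ge 2$ define $$q_M:=\frac{\log\left(\frac{\log M}{\log(M+1)}\right)}{\log\left(\frac{M}{M+1}\right)},$$ so that $(\log M)^k/M^{\sigma}=(\log(M+1))^k/(M+1)^{\sigma}$ exactly when $\sigma=kq_M$ (numerically $q_2\approx 1.13588$, $q_3\approx 0.808484$). *)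

theory Defs
  imports "HOL-Complex_Analysis.Complex_Analysis"
begin

definition is_zeta :: "(complex \<Rightarrow> complex) \<Rightarrow> bool" where
  "is_zeta f \<longleftrightarrow> f holomorphic_on - {1} \<and>
     (\<forall>s. Re s > 1 \<longrightarrow> (\<lambda>n. 1 / of_nat (Suc n) powr s) sums f s)"

(* The continuation exists (is_zeta_exists) and is unique away from the pole (is_zeta_unique);
   only the value at 1 is left unspecified. *)
definition zeta :: "complex \<Rightarrow> complex" where
  "zeta = (SOME f. is_zeta f)"

definition zeta_q :: "nat \<Rightarrow> real" where
  "zeta_q M = ln (ln (real M) / ln (real (M + 1))) / ln (real M / real (M + 1))"

(* Existence of the continuation. Expand (n + 1) powr (1 - s) around n up to order N and sum over n:
   the left-hand side telescopes, the remainder "rem" sums to a function holomorphic on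
   Re s > 1 - N, and (s - 1) * zeta s is expressed through its values at s + 1, s + 2, ... *)
context
begin

private definition ff :: "nat \<Rightarrow> complex \<Rightarrow> complex" where
  "ff j a = (\<Prod>i<j. a - of_nat i)"

private definition rem :: "nat \<Rightarrow> nat \<Rightarrow> complex \<Rightarrow> complex" where
  "rem N n s = of_nat (Suc (Suc n)) powr (1 - s) -
     (\<Sum>j\<le>N. ff j (1 - s) / fact j * of_nat (Suc n) powr (1 - s - of_nat j))"

private definition Z :: "complex \<Rightarrow> complex" where
  "Z s = (\<Sum>n. 1 / of_nat (Suc n) powr s)"

private lemma ff_holo [holomorphic_intros]:
  "f holomorphic_on A \<Longrightarrow> (\<lambda>s. ff j (f s)) holomorphic_on A"
  unfolding ff_def by (intro holomorphic_intros)

private lemma summable_powr: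
  assumes "c < -1" shows "summable (\<lambda>n. real (Suc n) powr c)"
  using assms summable_real_powr_iff[of c] summable_Suc_iff[of "\<lambda>n. real n powr c"] by simp

private lemma norm_nat_powr: "norm (of_nat (Suc n) powr (s::complex)) = real (Suc n) powr Re s"
  by (subst norm_powr_real_powr) (auto simp del: of_nat_Suc)

private lemma Z_sums: 
  assumes "Re s > 1" shows "(\<lambda>n. of_nat (Suc n) powr (-s)) sums Z s"
proof -
  have "summable (\<lambda>n. of_nat (Suc n) powr (-s))"
    by (rule summable_norm_cancel) (use assms in \<open>simp only: norm_nat_powr, auto intro!: summable_powr simp del: of_nat_Suc\<close>)
  thus ?thesis unfolding Z_def by (simp add: powr_minus_divide summable_sums)
qed

private lemma rem_bound:
  assumes "Re s \<ge> c" "c + real N > 0"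
  shows "norm (rem N n s) \<le> norm (ff (Suc N) (1 - s)) * real (Suc n) powr (- c - real N)"
proof -
  define S where "S = closed_segment (of_nat (Suc n)) (of_nat (Suc (Suc n)) :: complex)"
  define f where "f = (\<lambda>j (x::complex). ff j (1 - s) * x powr (1 - s - of_nat j))"
  define B where "B = norm (ff (Suc N) (1 - s)) * real (Suc n) powr (- c - real N)"
  have S: "\<exists>r. x = of_real r \<and> r \<ge> real (Suc n)" if "x \<in> S" for x
  proof -
    have "x \<in> closed_segment (of_real (real (Suc n))) (of_real (real (Suc (Suc n))))"
      using that by (simp add: S_def)
    thus ?thesis
      unfolding closed_segment_of_real closed_segment_eq_real_ivl by (auto split: if_splits)
  qed
  have "norm (f 0 (of_nat (Suc (Suc n))) - (\<Sum>i\<le>N. f i (of_nat (Suc n)) * (of_nat (Suc (Suc n)) - of_nat (Suc n)) ^ i / fact i))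
     \<le> B * norm (of_nat (Suc (Suc n)) - of_nat (Suc n) :: complex) ^ Suc N / fact N"
  proof (rule complex_Taylor[where S = S])
    show "convex S" "of_nat (Suc n) \<in> S" "of_nat (Suc (Suc n)) \<in> S" by (simp_all add: S_def)
    show "(f i has_field_derivative f (Suc i) x) (at x within S)" if xS: "x \<in> S" for i x
    proof -
      obtain r where r: "x = of_real r" "r \<ge> real (Suc n)" using S[OF xS] by blast
      have "x \<notin> \<real>\<^sub>\<le>\<^sub>0" using r by auto
      from DERIV_cmult[OF has_field_derivative_powr[OF this, of "1 - s - of_nat i"], of "ff i (1 - s)"]
      have "(f i has_field_derivative ff i (1 - s) * ((1 - s - of_nat i) * x powr (1 - s - of_nat i - 1))) (at x)"
        by (simp add: f_def)
      also have "ff i (1 - s) * ((1 - s - of_nat i) * x powr (1 - s - of_nat i - 1)) = f (Suc i) x"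
        by (simp add: f_def ff_def algebra_simps)
      finally show ?thesis by (rule has_field_derivative_at_within)
    qed
    show "norm (f (Suc N) x) \<le> B" if xS: "x \<in> S" for x
    proof -
      obtain r where r: "x = of_real r" "r \<ge> real (Suc n)" using S[OF xS] by blast
      have "norm (x powr (1 - s - of_nat (Suc N))) = r powr (- Re s - real N)"
        using r by (subst norm_powr_real_powr) auto
      also have "\<dots> \<le> real (Suc n) powr (- Re s - real N)"
        using r assms by (intro powr_mono2') auto
      also have "\<dots> \<le> real (Suc n) powr (- c - real N)"
        using assms by (intro powr_mono) auto
      finally show ?thesis unfolding f_def B_def norm_mult by (intro mult_left_mono) auto
    qed
  qed
  also have "f 0 (of_nat (Suc (Suc n))) - (\<Sum>i\<le>N. f i (of_nat (Suc n)) * (of_nat (Suc (Suc n)) - of_nat (Suc n)) ^ i / fact i) = rem N n s"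
    by (simp add: f_def rem_def ff_def)
  also have "B * norm (of_nat (Suc (Suc n)) - of_nat (Suc n) :: complex) ^ Suc N / fact N \<le> B / 1"
    by (simp, intro divide_left_mono[where b=1, simplified]) (auto simp: B_def)
  finally show ?thesis by (simp add: B_def)
qed

private lemma rem_holo: "(\<lambda>s. \<Sum>n. rem N n s) holomorphic_on {s. Re s > 1 - real N}"
proof (rule holomorphic_uniform_sequence[where f = "\<lambda>m s. \<Sum>n<m. rem N n s"])
  show "open {s. Re s > 1 - real N}" by (rule open_halfspace_Re_gt)
  show "(\<lambda>s. \<Sum>n<m. rem N n s) holomorphic_on {s. Re s > 1 - real N}" for m
    unfolding rem_def by (intro holomorphic_intros) auto
  fix s assume "s \<in> {s. Re s > 1 - real N}"
  hence s: "Re s > 1 - real N" by simp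
  define d where "d = (Re s - (1 - real N)) / 2"
  define c where "c = Re s - d"
  have d: "d > 0" using s by (simp add: d_def)
  have c: "c > 1 - real N" using s by (simp add: c_def d_def field_simps)
  have Re: "Re z \<ge> c" if "z \<in> cball s d" for z
    using that abs_Re_le_cmod[of "s - z"] by (simp add: c_def dist_norm)
  have "compact ((\<lambda>s. ff (Suc N) (1 - s)) ` cball s d)"
    by (intro compact_continuous_image holomorphic_on_imp_continuous_on holomorphic_intros) auto
  then obtain K where K: "\<And>z. z \<in> cball s d \<Longrightarrow> norm (ff (Suc N) (1 - z)) \<le> K"
    using compact_imp_bounded bounded_iff by (metis imageI)
  have "uniform_limit (cball s d) (\<lambda>m z. \<Sum>n<m. rem N n z) (\<lambda>z. \<Sum>n. rem N n z) sequentially"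
  proof (rule Weierstrass_m_test)
    show "norm (rem N n z) \<le> K * real (Suc n) powr (- c - real N)" if "z \<in> cball s d" for n z
    proof -
      have "norm (rem N n z) \<le> norm (ff (Suc N) (1 - z)) * real (Suc n) powr (- c - real N)"
        using Re[OF that] c by (intro rem_bound) auto
      also have "\<dots> \<le> K * real (Suc n) powr (- c - real N)"
        using K[OF that] by (intro mult_right_mono) auto
      finally show ?thesis .
    qed
    show "summable (\<lambda>n. K * real (Suc n) powr (- c - real N))"
      using c by (intro summable_mult summable_powr) auto
  qed
  thus "\<exists>d>0. cball s d \<subseteq> {s. Re s > 1 - real N} \<and>
      uniform_limit (cball s d) (\<lambda>m z. \<Sum>n<m. rem N n z) (\<lambda>z. \<Sum>n. rem N n z) sequentially"
    using d c Re by (intro exI[of _ d]) (force)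
qed

private lemma telescope:
  assumes "Re s > 1"
  shows "(\<lambda>n. of_nat (Suc (Suc n)) powr (1 - s) - of_nat (Suc n) powr (1 - s)) sums (- 1 :: complex)"
proof -
  have "(\<lambda>n. real (Suc n) powr (1 - Re s)) \<longlonglongrightarrow> 0"
    using assms by (intro tendsto_neg_powr filterlim_compose[OF filterlim_real_sequentially filterlim_Suc]) auto
  hence "(\<lambda>n. of_nat (Suc n) powr (1 - s)) \<longlonglongrightarrow> 0"
    by (subst tendsto_norm_zero_iff [symmetric]) (simp add: norm_nat_powr del: of_nat_Suc)
  from telescope_sums[OF this] show ?thesis by simp
qed

private lemma rec:
  assumes "Re s > 1"
  shows "(s - 1) * Z s = 1 + (\<Sum>n. rem (Suc N) n s) -
           (\<Sum>j\<in>{2..Suc N}. ff (j - 1) (1 - s) / fact j * ((s + of_nat j - 1 - 1) * Z (s + of_nat j - 1)))"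
proof -
  let ?b = "\<lambda>j. ff j (1 - s) / fact j"
  have zs: "(\<lambda>n. ?b j * of_nat (Suc n) powr (1 - s - of_nat j)) sums (?b j * Z (s + of_nat j - 1))"
    if "j \<ge> 1" for j
  proof -
    have "(\<lambda>n. of_nat (Suc n) powr (- (s + of_nat j - 1))) sums Z (s + of_nat j - 1)"
      using assms that by (intro Z_sums) auto
    thus ?thesis by (intro sums_mult) (simp add: algebra_simps)
  qed
  have split: "{..Suc N} = insert 0 {1..Suc N}" "{1..Suc N} = insert 1 {2..Suc N}" by auto
  have "(\<lambda>n. (of_nat (Suc (Suc n)) powr (1 - s) - of_nat (Suc n) powr (1 - s)) -
          (\<Sum>j\<in>{1..Suc N}. ?b j * of_nat (Suc n) powr (1 - s - of_nat j)))
        sums (- 1 - (\<Sum>j\<in>{1..Suc N}. ?b j * Z (s + of_nat j - 1)))"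
    by (intro sums_diff telescope assms sums_sum zs) auto
  also have "(\<lambda>n. (of_nat (Suc (Suc n)) powr (1 - s) - of_nat (Suc n) powr (1 - s)) -
          (\<Sum>j\<in>{1..Suc N}. ?b j * of_nat (Suc n) powr (1 - s - of_nat j))) = (\<lambda>n. rem (Suc N) n s)"
    unfolding rem_def split(1) by (subst sum.insert) (auto simp: ff_def simp del: sum.cl_ivl_Suc)
  finally have "(\<Sum>n. rem (Suc N) n s) = - 1 - (\<Sum>j\<in>{1..Suc N}. ?b j * Z (s + of_nat j - 1))"
    by (simp add: sums_iff)
  also have "(\<Sum>j\<in>{1..Suc N}. ?b j * Z (s + of_nat j - 1)) =
     (1 - s) * Z s + (\<Sum>j\<in>{2..Suc N}. ?b j * Z (s + of_nat j - 1))"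
    unfolding split(2) by (subst sum.insert) (auto simp: ff_def simp del: sum.cl_ivl_Suc)
  also have "(\<Sum>j\<in>{2..Suc N}. ?b j * Z (s + of_nat j - 1)) =
     - (\<Sum>j\<in>{2..Suc N}. ff (j - 1) (1 - s) / fact j * ((s + of_nat j - 1 - 1) * Z (s + of_nat j - 1)))"
    unfolding sum_negf [symmetric]
  proof (rule sum.cong)
    fix j assume "j \<in> {2..Suc N}"
    then obtain i where i: "j = Suc i" by (cases j) auto
    have "ff j (1 - s) = - (ff (j - 1) (1 - s) * (s + of_nat j - 1 - 1))"
      by (simp add: i ff_def algebra_simps)
    thus "?b j * Z (s + of_nat j - 1) =
       - (ff (j - 1) (1 - s) / fact j * ((s + of_nat j - 1 - 1) * Z (s + of_nat j - 1)))"
      by simp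
  qed auto
  finally show ?thesis by (simp add: algebra_simps)
qed

private definition cont :: "nat \<Rightarrow> (complex \<Rightarrow> complex) \<Rightarrow> bool" where
  "cont N G \<longleftrightarrow> G holomorphic_on {s. Re s > 1 - real N} \<and> (\<forall>s. Re s > 1 \<longrightarrow> G s = (s - 1) * Z s)"

private lemma cont_step:
  assumes "N = 0 \<or> cont N G" shows "\<exists>G. cont (Suc N) G"
proof -
  define H where "H = (\<lambda>s. 1 + (\<Sum>n. rem (Suc N) n s) -
           (\<Sum>j\<in>{2..Suc N}. ff (j - 1) (1 - s) / fact j * G (s + of_nat j - 1)))"
  have "(\<lambda>s. G (s + of_nat j - 1)) holomorphic_on {s. Re s > 1 - real (Suc N)}" if "j \<in> {2..Suc N}" for j
  proof -
    have "N \<noteq> 0" using that by auto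
    hence "G holomorphic_on {s. Re s > 1 - real N}" using assms by (simp add: cont_def)
    moreover have "real j \<ge> 2" using that by simp
    ultimately show ?thesis
      by (intro holomorphic_on_compose_gen[where f = "\<lambda>s. s + of_nat j - 1" and g = G, unfolded o_def]
            holomorphic_intros) auto
  qed
  hence "H holomorphic_on {s. Re s > 1 - real (Suc N)}"
    unfolding H_def by (intro holomorphic_intros rem_holo) auto
  moreover have "H s = (s - 1) * Z s" if "Re s > 1" for s
  proof -
    have "G (s + of_nat j - 1) = (s + of_nat j - 1 - 1) * Z (s + of_nat j - 1)" if "j \<in> {2..Suc N}" for j
      using that assms \<open>Re s > 1\<close> by (auto simp: cont_def)
    thus ?thesis unfolding rec[OF that, of N] H_def by simp
  qed
  ultimately show ?thesis by (auto simp: cont_def)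
qed

private lemma cont_ex: "\<exists>G. cont (Suc N) G"
  by (induction N) (use cont_step in blast)+

private lemma cont_eq:
  assumes "cont N G" "cont M H" "N \<le> M" "Re s > 1 - real N"
  shows "G s = H s"
proof (rule analytic_continuation_open[of "{s. Re s > 1}" "{s. Re s > 1 - real N}" G H])
  show "open {s. Re s > 1}" "open {s. Re s > 1 - real N}" by (rule open_halfspace_Re_gt)+
  show "connected {s. Re s > 1 - real N}" by (intro convex_connected convex_halfspace_Re_gt)
  have "(2::complex) \<in> {s. Re s > 1}" by simp
  thus "{s. Re s > 1} \<noteq> {}" by blast
  show "G holomorphic_on {s. Re s > 1 - real N}" using assms by (simp add: cont_def)
  have "H holomorphic_on {s. Re s > 1 - real M}" using assms by (simp add: cont_def)
  thus "H holomorphic_on {s. Re s > 1 - real N}" 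
    by (rule holomorphic_on_subset) (use assms in auto)
qed (use assms in \<open>auto simp: cont_def\<close>)

lemma is_zeta_exists: "\<exists>f. is_zeta f"
proof -
  obtain G where G: "\<And>N. cont (Suc N) (G N)" using cont_ex by metis
  define F where "F = (\<lambda>s. G (nat \<lceil>1 - Re s\<rceil>) s)"
  have FG: "F s = G N s" if "Re s > 1 - real (Suc N)" for s N
  proof -
    define M where "M = nat \<lceil>1 - Re s\<rceil>"
    have M: "Re s > 1 - real (Suc M)" unfolding M_def by (simp; linarith)
    have "G M s = G N s"
    proof (cases "M \<le> N")
      case True
      thus ?thesis by (intro cont_eq[OF G G _ M]) simp
    next
      case False
      thus ?thesis by (intro cont_eq[OF G G _ that, symmetric]) simp
    qed
    thus ?thesis by (simp only: F_def M_def)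
  qed
  have "F holomorphic_on (\<Union>N. {s. Re s > 1 - real (Suc N)})"
  proof (rule holomorphic_on_UN_open)
    show "F holomorphic_on {s. Re s > 1 - real (Suc N)}" for N
      using G[of N] FG by (subst holomorphic_cong[OF refl, of _ _ "G N"]) (auto simp: cont_def)
  qed (rule open_halfspace_Re_gt)
  moreover have "s \<in> (\<Union>N. {s. Re s > 1 - real (Suc N)})" for s
    by (auto intro!: exI[of _ "nat \<lceil>1 - Re s\<rceil>"]) linarith
  ultimately have F: "F holomorphic_on UNIV"
    by (blast intro: holomorphic_on_subset)
  define f where "f = (\<lambda>s. F s / (s - 1))"
  have "f holomorphic_on - {1}" unfolding f_def
    by (intro holomorphic_intros holomorphic_on_subset[OF F]) auto
  moreover have "(\<lambda>n. 1 / of_nat (Suc n) powr s) sums f s" if "Re s > 1" for s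
  proof -
    have "F s = (s - 1) * Z s" using FG[of 0 s] G[of 0] that by (simp add: cont_def)
    moreover have "s \<noteq> 1" using that by auto
    ultimately have "f s = Z s" by (simp add: f_def)
    with Z_sums[OF that] show ?thesis by (simp add: powr_minus_divide)
  qed
  ultimately show ?thesis by (auto simp: is_zeta_def)
qed

end

lemma is_zeta_unique:
  assumes "is_zeta f" "is_zeta g" "s \<noteq> 1"
  shows "f s = g s"
proof (rule analytic_continuation_open[of "{s. Re s > 1}" "- {1}" f g])
  show "open {s. Re s > 1}" by (rule open_halfspace_Re_gt)
  show "connected (- {1::complex})" by (intro connected_punctured_universe) auto
  have "(2::complex) \<in> {s. Re s > 1}" by simp
  thus "{s. Re s > 1} \<noteq> {}" by blast
  show "f z = g z" if "z \<in> {s. Re s > 1}" for z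
    using assms that by (auto simp: is_zeta_def intro: sums_unique2)
qed (use assms in \<open>auto simp: is_zeta_def\<close>)

lemma is_zeta_zeta: "is_zeta zeta"
  unfolding zeta_def by (rule someI_ex[OF is_zeta_exists])

lemma holomorphic_zeta: "zeta holomorphic_on - {1}"
  and zeta_sums: "Re s > 1 \<Longrightarrow> (\<lambda>n. 1 / of_nat (Suc n) powr s) sums zeta s"
  using is_zeta_zeta by (simp_all add: is_zeta_def)

end

theory Submission
  imports Defs
begin

text \<open>
  On the line \<open>Re s = \<sigma>\<close> the \<open>M\<close>-th term of the Dirichlet series of the \<open>k\<close>-th derivative of zeta
  dominates the sum of all others in absolute value. With \<open>Q n = (ln n)^k / n^\<sigma>\<close> one has
  \<open>Q n / Q (n + 1) = ((n + 1) / n) powr (\<sigma> - k q n)\<close>, and \<open>q n\<close> is the mean of \<open>1 / u\<close> over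
  \<open>ln n \<le> u \<le> ln (n + 1)\<close>, so \<open>q\<close> is decreasing and convex.
  Monotonicity gives \<open>Q n \<le> Q M (M / n) powr a\<close> with \<open>a = (M + 1) ln 3\<close> for \<open>n \<ge> M\<close>, and comparison with an
  integral bounds the terms after \<open>M\<close>. Before \<open>M\<close>, monotonicity alone gives ratios below \<open>1 / 3\<close>, hence
  only the sum \<open>Q M / 2\<close>, which is too weak. However, a nonempty range for \<open>\<sigma>\<close> forces
  \<open>k (q (M - 1) - q M) \<ge> (2 M + 1) ln 3\<close>, and by convexity all ratios \<open>Q n / Q (n + 1)\<close> with
  \<open>n \<le> M - 2\<close> are then at most \<open>1 / 27\<close>, so that the terms before \<open>M\<close> sum to at most \<open>9 / 26 Q M\<close>.
  In part (a), \<open>M = 3\<close> and only \<open>Q 2 \<le> (2 / 3)^2 Q 3\<close> precedes, so the later terms may sum to \<open>5 / 9 Q 3\<close>.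
\<close>

section \<open>Integral representation, monotonicity and convexity of \<open>zeta_q\<close>\<close>

text \<open>Substituting u = (1 - t) a + t b gives the mean of 1 / u between a and b. The fixed
  range 0..1 lets the means for different n be compared pointwise in t.\<close>

lemma has_integral_inverse_affine:
  fixes a b :: real
  assumes "0 < a" "a < b"
  shows "((\<lambda>t. 1 / ((1 - t) * a + t * b)) has_integral (ln b - ln a) / (b - a)) {0..1}"
proof -
  have pos: "(1 - t) * a + t * b > 0" if "t \<in> {0..1}" for t
  proof -
    have "(1 - t) * a + t * b = a + t * (b - a)" by (simp add: algebra_simps)
    thus ?thesis using assms that by (simp add: add_pos_nonneg)
  qed
  have "((\<lambda>t. 1 / ((1 - t) * a + t * b)) has_integral
      ln ((1 - 1) * a + 1 * b) / (b - a) - ln ((1 - 0) * a + 0 * b) / (b - a)) {0..1}"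
  proof (rule fundamental_theorem_of_calculus)
    fix t :: real assume t: "t \<in> {0..1}"
    have "((\<lambda>t. ln ((1 - t) * a + t * b) / (b - a)) has_real_derivative
        1 / ((1 - t) * a + t * b)) (at t within {0..1})"
      using pos[OF t] assms
      by (auto intro!: derivative_eq_intros simp: divide_simps)
    thus "((\<lambda>t. ln ((1 - t) * a + t * b) / (b - a)) has_vector_derivative
        1 / ((1 - t) * a + t * b)) (at t within {0..1})"
      by (simp add: has_real_derivative_iff_has_vector_derivative)
  qed simp
  thus ?thesis by (simp add: diff_divide_distrib)
qed

lemma zeta_q_eq:
  assumes "n \<ge> 2"
  shows "zeta_q n = (ln (ln (real n + 1)) - ln (ln (real n))) / (ln (real n + 1) - ln (real n))"
proof -
  have "ln (ln (real n) / ln (real n + 1)) = - (ln (ln (real n + 1)) - ln (ln (real n)))"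
    using assms by (subst ln_div) auto
  moreover have "ln (real n / (real n + 1)) = - (ln (real n + 1) - ln (real n))"
    using assms by (subst ln_div) auto
  ultimately show ?thesis
    unfolding zeta_q_def of_nat_add of_nat_1 by (simp only: minus_divide_divide)
qed

lemma zeta_q_has_integral:
  assumes "n \<ge> 2"
  shows "((\<lambda>t. 1 / ((1 - t) * ln (real n) + t * ln (real n + 1))) has_integral zeta_q n) {0..1}"
  using has_integral_inverse_affine[of "ln (real n)" "ln (real n + 1)"] assms
  by (simp add: zeta_q_eq)

lemma zeta_q_pos:
  assumes "n \<ge> 2"
  shows "zeta_q n > 0"
  unfolding zeta_q_eq[OF assms] using assms by (intro divide_pos_pos) auto

lemma ln_mix_pos:
  fixes x t :: real
  assumes "x > 1" "t \<in> {0..1}"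
  shows "(1 - t) * ln x + t * ln (x + 1) > 0"
proof (cases "t = 0")
  case False
  thus ?thesis using assms by (intro add_nonneg_pos mult_nonneg_nonneg mult_pos_pos) auto
qed (use assms in auto)

lemma zeta_q_antimono_Suc:
  assumes "n \<ge> 2"
  shows "zeta_q (Suc n) \<le> zeta_q n"
proof (rule has_integral_le[OF zeta_q_has_integral zeta_q_has_integral])
  fix t :: real assume t: "t \<in> {0..1}"
  have "(1 - t) * ln (real n) + t * ln (real n + 1) \<le>
        (1 - t) * ln (real (Suc n)) + t * ln (real (Suc n) + 1)"
    using t assms by (intro add_mono mult_left_mono) auto
  thus "1 / ((1 - t) * ln (real (Suc n)) + t * ln (real (Suc n) + 1)) \<le>
        1 / ((1 - t) * ln (real n) + t * ln (real n + 1))"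
    using ln_mix_pos[of "real n" t] t assms by (intro divide_left_mono) (auto intro!: mult_pos_pos)
qed (use assms in auto)

lemma zeta_q_antimono:
  assumes "2 \<le> m" "m \<le> n"
  shows "zeta_q n \<le> zeta_q m"
  using assms(2,1)
proof (induction rule: dec_induct)
  case (step n)
  thus ?case using zeta_q_antimono_Suc[of n] by simp
qed simp

text \<open>Because (x - 1) (x + 1) < x * x. The convexity of \<open>zeta_q\<close> rests on this
  midpoint form of the concavity of \<open>ln\<close>.\<close>

lemma two_ln_ge:
  fixes x :: real
  assumes "x > 1"
  shows "ln (x - 1) + ln (x + 1) \<le> 2 * ln x"
proof -
  have "ln (x - 1) + ln (x + 1) = ln ((x - 1) * (x + 1))"
    using assms by (subst ln_mult) auto
  also have "\<dots> \<le> ln (x * x)" using assms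
    by (subst ln_le_cancel_iff) (auto simp: algebra_simps intro: mult_strict_mono less_1_mult)
  also have "\<dots> = 2 * ln x" using assms by (subst ln_mult) auto
  finally show ?thesis .
qed

text \<open>The integrand of \<open>zeta_q_has_integral\<close> is the reciprocal of a positive concave function of
  \<open>n\<close>, hence convex in \<open>n\<close>.\<close>

lemma zeta_q_convex:
  assumes "n \<ge> 2"
  shows "2 * zeta_q (Suc n) \<le> zeta_q n + zeta_q (Suc (Suc n))"
proof (rule has_integral_le)
  show "((\<lambda>t. 2 * (1 / ((1 - t) * ln (real (Suc n)) + t * ln (real (Suc n) + 1))))
          has_integral 2 * zeta_q (Suc n)) {0..1}"
    using assms by (intro has_integral_mult_right zeta_q_has_integral) auto
  show "((\<lambda>t. 1 / ((1 - t) * ln (real n) + t * ln (real n + 1)) +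
            1 / ((1 - t) * ln (real (Suc (Suc n))) + t * ln (real (Suc (Suc n)) + 1)))
          has_integral zeta_q n + zeta_q (Suc (Suc n))) {0..1}"
    using assms by (intro has_integral_add zeta_q_has_integral) auto
  fix t :: real assume t: "t \<in> {0..1}"
  define g where "g = (\<lambda>x. (1 - t) * ln x + t * ln (x + 1))"
  define x where "x = real n + 1"
  have x: "x \<ge> 3" using assms by (simp add: x_def)
  have pos: "g (x - 1) > 0" "g x > 0" "g (x + 1) > 0"
    unfolding g_def using ln_mix_pos[of "x - 1" t] ln_mix_pos[of x t] ln_mix_pos[of "x + 1" t] x t
    by auto
  have "g (x - 1) + g (x + 1) =
      (1 - t) * (ln (x - 1) + ln (x + 1)) + t * (ln ((x + 1) - 1) + ln ((x + 1) + 1))"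
    by (simp add: g_def algebra_simps)
  also have "\<dots> \<le> (1 - t) * (2 * ln x) + t * (2 * ln (x + 1))"
    using x t by (intro add_mono mult_left_mono two_ln_ge) auto
  also have "\<dots> = 2 * g x" by (simp add: g_def)
  finally have le: "g (x - 1) + g (x + 1) \<le> 2 * g x" .
  have "2 * (1 / g x) \<le> 4 / (g (x - 1) + g (x + 1))"
    using le pos by (simp add: field_simps)
  \<comment> \<open>The harmonic mean is at most the arithmetic mean.\<close>
  also have "\<dots> \<le> 1 / g (x - 1) + 1 / g (x + 1)"
  proof -
    have "0 \<le> (g (x - 1) - g (x + 1)) ^ 2" by simp
    thus ?thesis using pos by (simp add: field_simps power2_eq_square)
  qed
  finally show "2 * (1 / ((1 - t) * ln (real (Suc n)) + t * ln (real (Suc n) + 1))) \<le>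
      1 / ((1 - t) * ln (real n) + t * ln (real n + 1)) +
      1 / ((1 - t) * ln (real (Suc (Suc n))) + t * ln (real (Suc (Suc n)) + 1))"
    by (simp add: g_def x_def add_ac)
qed

section \<open>Absolute values of the terms and their ratios\<close>

text \<open>The \<open>Q n\<close> of the introduction. At n = 0 it is 0, since
  \<open>0 powr x = 0\<close>; at n = 1 it is 0 only for k > 0.\<close>

definition zterm :: "nat \<Rightarrow> real \<Rightarrow> nat \<Rightarrow> real" where
  "zterm k \<sigma> n = ln (real n) ^ k * real n powr (- \<sigma>)"

lemma zterm_nonneg: "zterm k \<sigma> n \<ge> 0"
  by (cases "n = 0") (auto simp: zterm_def)

lemma zterm_pos: "n \<ge> 2 \<Longrightarrow> zterm k \<sigma> n > 0"
  by (simp add: zterm_def)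

lemma zterm_1: "k > 0 \<Longrightarrow> zterm k \<sigma> (Suc 0) = 0"
  by (simp add: zterm_def)

lemma zterm_exp:
  assumes "n \<ge> 2"
  shows "zterm k \<sigma> n = exp (real k * ln (ln (real n)) - \<sigma> * ln (real n))"
  using assms by (simp add: zterm_def exp_diff exp_of_nat_mult powr_def exp_minus field_simps)

text \<open>\<open>zeta_q n\<close> is the difference quotient of ln ln with respect to ln, so the
  gap of the logarithms factors out of the exponent.\<close>

lemma zterm_Suc:
  assumes "n \<ge> 2"
  shows "zterm k \<sigma> n = zterm k \<sigma> (Suc n) *
           exp ((\<sigma> - real k * zeta_q n) * (ln (real n + 1) - ln (real n)))"
proof -
  have "ln (real n + 1) - ln (real n) > 0" using assms by simp
  hence "zeta_q n * (ln (real n + 1) - ln (real n)) = ln (ln (real n + 1)) - ln (ln (real n))"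
    unfolding zeta_q_eq[OF assms] by simp
  hence "real k * zeta_q n * (ln (real n + 1) - ln (real n)) =
      real k * (ln (ln (real n + 1)) - ln (ln (real n)))"
    by (simp add: mult.assoc)
  thus ?thesis using assms
    by (simp add: zterm_exp exp_add [symmetric] algebra_simps)
qed

lemma ln_Suc_diff_ge:
  assumes "n \<ge> 1"
  shows "1 / (real n + 1) \<le> ln (real n + 1) - ln (real n)"
proof -
  have "ln (real n / (real n + 1)) \<le> real n / (real n + 1) - 1"
    using assms by (intro ln_le_minus_one) auto
  also have "\<dots> = - (1 / (real n + 1))" by (simp add: field_simps)
  finally show ?thesis using assms by (simp add: ln_div)
qed

text \<open>The logarithms of n and n + 1 differ by at least 1 / (n + 1), which cancels the factor n
  + 1 in the hypothesis and leaves a ratio independent of n.\<close>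

lemma zterm_le_exp_mult_zterm_Suc:
  assumes "n \<ge> 2" "\<sigma> - real k * zeta_q n \<le> - c * (real n + 1)" "c \<ge> 0"
  shows "zterm k \<sigma> n \<le> exp (- c) * zterm k \<sigma> (Suc n)"
proof -
  let ?d = "ln (real n + 1) - ln (real n)"
  have d: "1 / (real n + 1) \<le> ?d" using assms by (intro ln_Suc_diff_ge) auto
  have "(\<sigma> - real k * zeta_q n) * ?d \<le> - c * (real n + 1) * ?d"
    using assms by (intro mult_right_mono) auto
  also have "\<dots> \<le> - c"
    using mult_left_mono[OF d, of "c * (real n + 1)"] assms by simp
  finally have "exp ((\<sigma> - real k * zeta_q n) * ?d) \<le> exp (- c)" by simp
  thus ?thesis unfolding zterm_Suc[OF assms(1)]
    using zterm_nonneg[of k \<sigma> "Suc n"] by (subst mult.commute) (intro mult_right_mono)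
qed

text \<open>As \<open>zeta_q\<close> decreases, \<sigma> - k \<open>zeta_q n\<close> stays at least
  a from M on. Each step then contributes a factor of at most (n / (n + 1)) powr a, and these
  telescope.\<close>

lemma zterm_le_powr:
  assumes "2 \<le> M" "M \<le> n" "real k * zeta_q M + a \<le> \<sigma>"
  shows "zterm k \<sigma> n \<le> zterm k \<sigma> M * (real M / real n) powr a"
  using assms(2)
proof (induction rule: dec_induct)
  case base
  thus ?case using assms by simp
next
  case (step n)
  define d where "d = ln (real n + 1) - ln (real n)"
  have n: "n \<ge> 2" using step assms by simp
  have "real k * zeta_q n \<le> real k * zeta_q M"
    using step assms by (intro mult_left_mono zeta_q_antimono) auto
  hence "a * d \<le> (\<sigma> - real k * zeta_q n) * d"
    using assms n by (intro mult_right_mono) (auto simp: d_def)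
  hence "zterm k \<sigma> (Suc n) * exp (a * d) \<le> zterm k \<sigma> n"
    unfolding zterm_Suc[OF n, folded d_def] by (intro mult_left_mono zterm_nonneg) simp
  also have "\<dots> \<le> zterm k \<sigma> M * (real M / real n) powr a" by (rule step.IH)
  finally have "zterm k \<sigma> (Suc n) \<le> zterm k \<sigma> M * ((real M / real n) powr a * exp (- (a * d)))"
    by (simp add: exp_minus field_simps)
  also have "(real M / real n) powr a * exp (- (a * d)) = (real M / real (Suc n)) powr a"
    using assms n by (simp add: d_def powr_def ln_div exp_add [symmetric] algebra_simps)
  finally show ?case .
qed

section \<open>Bounds for sums of terms on either side of a given one\<close>

text \<open>The bound is the integral of x powr (- a) from P to infinity.\<close>

lemma sum_powr_tail_le:
  fixes a :: real
  assumes "P \<ge> 1" "a > 1"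
  shows "(\<Sum>n\<in>{P<..N}. real n powr (- a)) \<le> real P powr (1 - a) / (a - 1)"
proof (cases "P \<le> N")
  case True
  \<comment> \<open>Subtracting the integral beyond N gives a bound that can be proved by induction
    on N.\<close>
  hence "(\<Sum>n\<in>{P<..N}. real n powr (- a)) \<le> (real P powr (1 - a) - real N powr (1 - a)) / (a - 1)"
  proof (induction rule: dec_induct)
    case (step n)
    have n: "n \<ge> 1" using step assms by simp
    have "1 + (a - 1) / (real n + 1) \<le> 1 + (a - 1) * (ln (real n + 1) - ln (real n))"
      using mult_left_mono[OF ln_Suc_diff_ge[OF n], of "a - 1"] assms by simp
    also have "\<dots> \<le> exp ((a - 1) * (ln (real n + 1) - ln (real n)))" by (rule exp_ge_add_one_self)
    also have "\<dots> = real n powr (1 - a) / (real n + 1) powr (1 - a)"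
      using n by (simp add: powr_def exp_diff [symmetric] algebra_simps)
    finally have "(1 + (a - 1) / (real n + 1)) * (real n + 1) powr (1 - a) \<le> real n powr (1 - a)"
      by (simp add: field_simps)
    moreover have "(real n + 1) powr (1 - a) / (real n + 1) = (real n + 1) powr (- a)"
      by (simp add: powr_diff powr_minus_divide)
    hence "(1 + (a - 1) / (real n + 1)) * (real n + 1) powr (1 - a) =
        (real n + 1) powr (1 - a) + (a - 1) * (real n + 1) powr (- a)"
      by (metis distrib_right mult_1 times_divide_eq_left times_divide_eq_right)
    ultimately have "(a - 1) * real (Suc n) powr (- a) \<le> real n powr (1 - a) - real (Suc n) powr (1 - a)"
      by (simp add: add_ac)
    hence "real (Suc n) powr (- a) \<le> (real n powr (1 - a) - real (Suc n) powr (1 - a)) / (a - 1)"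
      using assms by (simp add: pos_le_divide_eq mult.commute)
    moreover have "{P<..Suc n} = insert (Suc n) {P<..n}" using step by auto
    ultimately show ?case using step.IH by (simp add: diff_divide_distrib)
  qed simp
  also have "\<dots> \<le> real P powr (1 - a) / (a - 1)"
    using assms by (intro divide_right_mono) auto
  finally show ?thesis .
qed (use assms in simp)

text \<open>The term at P is kept and those beyond it are compared with the integral. A choice P > M
  + 1 leaves the terms between M and P to a direct estimate.\<close>

lemma zterm_tail_le:
  assumes "2 \<le> M" "M < P" "real k * zeta_q M + a \<le> \<sigma>" "a > 1"
  shows "(\<Sum>n\<in>{P..N}. zterm k \<sigma> n) \<le>
           zterm k \<sigma> M * ((real M / real P) powr a * (1 + real P / (a - 1)))"
proof (cases "P \<le> N")
  case True
  have "(\<Sum>n\<in>{P..N}. zterm k \<sigma> n) \<le> (\<Sum>n\<in>{P..N}. zterm k \<sigma> M * real M powr a * real n powr (- a))"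
    using assms
    by (intro sum_mono order_trans[OF zterm_le_powr[of M _ k a]])
       (auto simp: powr_divide powr_minus_divide)
  also have "\<dots> = zterm k \<sigma> M * real M powr a * (\<Sum>n\<in>{P..N}. real n powr (- a))"
    by (simp add: sum_distrib_left)
  also have "(\<Sum>n\<in>{P..N}. real n powr (- a)) \<le> real P powr (- a) + real P powr (1 - a) / (a - 1)"
  proof -
    have "{P..N} = insert P {P<..N}" using True by auto
    thus ?thesis using assms sum_powr_tail_le[of P a N] by simp
  qed
  also have "real P powr (- a) + real P powr (1 - a) / (a - 1) =
      real P powr (- a) * (1 + real P / (a - 1))"
    using assms by (simp add: powr_diff powr_minus_divide distrib_left)
  finally show ?thesis using assms zterm_nonneg[of k \<sigma> M]
    by (simp add: powr_divide powr_minus_divide mult_left_mono mult.assoc)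
qed (use assms in \<open>auto intro!: mult_nonneg_nonneg zterm_nonneg add_nonneg_nonneg\<close>)

text \<open>Going down from N, the terms shrink by the factor c at each step, so a geometric series
  with first term \<open>f N\<close> dominates the sum.\<close>

lemma geometric_sum_le:
  fixes f :: "nat \<Rightarrow> real"
  assumes "N \<ge> 1" "0 \<le> c" "c \<le> 1"
    and "\<And>n. 1 \<le> n \<Longrightarrow> n < N \<Longrightarrow> f n \<le> c * f (Suc n)" and "\<And>n. f n \<ge> 0"
  shows "(1 - c) * (\<Sum>n\<in>{1..N}. f n) \<le> f N"
  using assms(1,4)
proof (induction rule: dec_induct)
  case base
  have "0 \<le> c * f 1" using assms by simp
  thus ?case by (simp add: algebra_simps)
next
  case (step N)
  have "(1 - c) * (\<Sum>n\<in>{1..Suc N}. f n) = (1 - c) * (\<Sum>n\<in>{1..N}. f n) + (1 - c) * f (Suc N)"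
    by (simp add: distrib_left)
  also have "\<dots> \<le> c * f (Suc N) + (1 - c) * f (Suc N)"
    using step.IH step.prems step.hyps by (intro add_right_mono) force
  finally show ?case by (simp add: algebra_simps)
qed

section \<open>Estimates for logarithms\<close>

text \<open>Raising to the power 32 turns this into exp 1 ^ 35 \<le> 3 ^ 32, for which exp 1 < 2.72
  suffices. It yields the exponent 35 / 8 as a lower bound for 4 ln 3, convenient for rational
  arithmetic.\<close>

lemma ln_3_ge: "ln (3::real) \<ge> 35 / 32"
proof -
  have "exp (35 / 32 :: real) ^ 32 = exp 1 ^ 35"
    by (simp flip: exp_of_nat_mult)
  also have "\<dots> \<le> (272 / 100) ^ 35"
    using e_less_272 by (intro power_mono) auto
  also have "\<dots> \<le> (3::real) ^ 32" by (simp add: power_divide)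
  finally have "exp (35 / 32 :: real) \<le> 3" by (rule power_le_imp_le_base[of _ 31, simplified]) simp
  thus ?thesis by (subst ln_ge_iff) auto
qed

text \<open>The quadratic term matters for small M: with ln (1 - x) \<le> - x alone, the estimate
  for the terms after M = 3 would be about 0.73 Q M, above the admissible 17 / 26.\<close>

lemma ln_one_minus_le:
  fixes x :: real
  assumes "0 \<le> x" "x < 1"
  shows "ln (1 - x) \<le> - x - x ^ 2 / 2"
proof -
  have "- ln (1 - 0) - 0 - 0 ^ 2 / 2 \<le> - ln (1 - x) - x - x ^ 2 / 2"
  proof (rule DERIV_nonneg_imp_nondecreasing[OF assms(1), of "\<lambda>x. - ln (1 - x) - x - x ^ 2 / 2"])
    fix y assume y: "0 \<le> y" "y \<le> x"
    hence "((\<lambda>x. - ln (1 - x) - x - x ^ 2 / 2) has_real_derivative y ^ 2 / (1 - y)) (at y)"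
      using assms by (auto intro!: derivative_eq_intros simp: field_simps power2_eq_square)
    moreover have "y ^ 2 / (1 - y) \<ge> 0" using y assms by simp
    ultimately show "\<exists>d. ((\<lambda>x. - ln (1 - x) - x - x ^ 2 / 2) has_real_derivative d) (at y) \<and> d \<ge> 0"
      by blast
  qed
  thus ?thesis by simp
qed

section \<open>Termwise differentiation of the Dirichlet series\<close>

lemma holomorphic_dirichlet_poly:
  "(\<lambda>s. \<Sum>n<m. c n * of_nat (Suc n) powr (- s)) holomorphic_on A"
  by (intro holomorphic_intros)

lemma higher_deriv_dirichlet_poly:
  fixes c :: "nat \<Rightarrow> complex"
  shows "(deriv ^^ k) (\<lambda>s. \<Sum>n<m. c n * of_nat (Suc n) powr (- s)) =
    (\<lambda>s. \<Sum>n<m. c n * (- of_real (ln (real (Suc n)))) ^ k * of_nat (Suc n) powr (- s))"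
proof (induction k)
  case (Suc k)
  have "deriv (\<lambda>s. \<Sum>n<m. c n * (- of_real (ln (real (Suc n)))) ^ k * of_nat (Suc n) powr (- s)) s =
      (\<Sum>n<m. c n * (- of_real (ln (real (Suc n)))) ^ Suc k * of_nat (Suc n) powr (- s))" for s
  proof (rule DERIV_imp_deriv, rule DERIV_sum)
    fix n
    have "Ln (of_nat (Suc n)) = of_real (ln (real (Suc n)))"
      by (metis Ln_of_nat nat.simps(3) not_gr_zero)
    hence "((\<lambda>s. of_nat (Suc n) powr (- s)) has_field_derivative
        of_real (ln (real (Suc n))) * of_nat (Suc n) powr (- s) * (- 1)) (at s)"
      using DERIV_chain2[where f = "\<lambda>z. of_nat (Suc n) powr z" and g = uminus and x = s and Db = "- 1" and s = UNIV,
          OF has_field_derivative_powr_right[of "of_nat (Suc n)" "- s"] DERIV_minus[OF DERIV_ident]]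
      by (simp del: of_nat_Suc)
    from DERIV_cmult[OF this, of "c n * (- of_real (ln (real (Suc n)))) ^ k"]
    show "((\<lambda>s. c n * (- of_real (ln (real (Suc n)))) ^ k * of_nat (Suc n) powr (- s))
        has_field_derivative c n * (- of_real (ln (real (Suc n)))) ^ Suc k * of_nat (Suc n) powr (- s)) (at s)"
      by (simp add: mult_ac del: of_nat_Suc)
  qed
  thus ?case using Suc by simp
qed simp

text \<open>The partial sums are holomorphic and converge to \<open>zeta\<close> uniformly on a
  half-plane Re z > c with 1 < c < Re s, so their derivatives of order k converge at s.\<close>

lemma higher_deriv_zeta_sums:
  assumes "Re s > 1"
  shows "(\<lambda>n. (- of_real (ln (real (Suc n)))) ^ k * of_nat (Suc n) powr (- s)) sums (deriv ^^ k) zeta s"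
proof -
  \<comment> \<open>The factor 1 is the coefficient \<open>c n\<close> that
    \<open>higher_deriv_dirichlet_poly\<close> expects.\<close>
  define f where "f = (\<lambda>m s. \<Sum>n<m. 1 * (of_nat (Suc n) :: complex) powr (- s))"
  define c where "c = (1 + Re s) / 2"
  have c: "c > 1" "Re s > c" using assms by (auto simp: c_def)
  have lim: "uniform_limit {z. Re z > c} f zeta sequentially"
  proof -
    have "uniform_limit {z. Re z > c} f
        (\<lambda>z. \<Sum>n. 1 * (of_nat (Suc n) :: complex) powr (- z)) sequentially"
      unfolding f_def
    proof (rule Weierstrass_m_test)
      show "summable (\<lambda>n. real (Suc n) powr (- c))"
        using c summable_real_powr_iff[of "- c"] summable_Suc_iff[of "\<lambda>n. real n powr (- c)"] by simp
      fix n and z :: complex assume z: "z \<in> {z. Re z > c}"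
      have "norm (1 * (of_nat (Suc n) :: complex) powr (- z)) = real (Suc n) powr (- Re z)"
        by (simp del: of_nat_Suc, subst norm_powr_real_powr) (auto simp del: of_nat_Suc)
      also have "\<dots> \<le> real (Suc n) powr (- c)"
        using z by (intro powr_mono) auto
      finally show "norm (1 * (of_nat (Suc n) :: complex) powr (- z)) \<le> real (Suc n) powr (- c)" .
    qed
    moreover have "(\<Sum>n. 1 * (of_nat (Suc n) :: complex) powr (- z)) = zeta z" if "Re z > c" for z
      using zeta_sums[of z] that c by (simp add: powr_minus_divide sums_iff)
    ultimately show ?thesis
      by (metis (mono_tags, lifting) mem_Collect_eq uniform_limit_cong')
  qed
  have "(\<lambda>m. (deriv ^^ k) (f m) s) \<longlonglongrightarrow> (deriv ^^ k) zeta s"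
  proof (rule higher_deriv_complex_uniform_limit[OF lim])
    show "\<forall>\<^sub>F m in sequentially. f m holomorphic_on {z. c < Re z}"
      unfolding f_def by (intro always_eventually allI holomorphic_dirichlet_poly)
  qed (use c open_halfspace_Re_gt in auto)
  thus ?thesis
    unfolding f_def higher_deriv_dirichlet_poly sums_def by simp
qed

section \<open>Nonvanishing from a dominant term\<close>

text \<open>By the reverse triangle inequality every partial sum up to N \<ge> M has norm at least
  \<open>norm (f M) - (H + T)\<close>, and this positive bound survives the limit.\<close>

lemma sums_nonzero_if_dominant:
  fixes f :: "nat \<Rightarrow> 'a :: real_normed_vector"
  assumes "(\<lambda>n. f (Suc n)) sums S" "M \<ge> 1"
    and head: "(\<Sum>n\<in>{1..<M}. norm (f n)) \<le> H"
    and tail: "\<And>N. (\<Sum>n\<in>{M<..N}. norm (f n)) \<le> T"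
    and less: "H + T < norm (f M)"
  shows "S \<noteq> 0"
proof -
  have lim: "(\<lambda>N. norm (\<Sum>n\<in>{1..N}. f n)) \<longlonglongrightarrow> norm S"
    using assms(1) unfolding sums_def
    by (intro tendsto_norm) (simp add: sum.atLeast1_atMost_eq)
  have "norm (f M) - (H + T) \<le> norm (\<Sum>n\<in>{1..N}. f n)" if "N \<ge> M" for N
  proof -
    have split: "{1..N} = insert M ({1..<M} \<union> {M<..N})" using that assms by auto
    have "norm (\<Sum>n\<in>{1..<M} \<union> {M<..N}. f n) \<le> (\<Sum>n\<in>{1..<M} \<union> {M<..N}. norm (f n))"
      by (rule norm_sum)
    also have "\<dots> = (\<Sum>n\<in>{1..<M}. norm (f n)) + (\<Sum>n\<in>{M<..N}. norm (f n))"
      by (rule sum.union_disjoint) auto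
    also have "\<dots> \<le> H + T" by (intro add_mono head tail)
    finally have "norm (\<Sum>n\<in>{1..<M} \<union> {M<..N}. f n) \<le> H + T" .
    moreover have "(\<Sum>n\<in>{1..N}. f n) = f M + (\<Sum>n\<in>{1..<M} \<union> {M<..N}. f n)"
      unfolding split by (subst sum.insert) auto
    ultimately show ?thesis
      using norm_diff_ineq[of "f M" "\<Sum>n\<in>{1..<M} \<union> {M<..N}. f n"] by simp
  qed
  hence "norm (f M) - (H + T) \<le> norm S"
    by (intro tendsto_lowerbound[OF lim]) (auto simp: eventually_sequentially)
  thus ?thesis using less by auto
qed

lemma higher_deriv_zeta_nonzero:
  assumes "\<sigma> > 1" "M \<ge> 1"
    and "(\<Sum>n\<in>{1..<M}. zterm k \<sigma> n) \<le> H" "\<And>N. (\<Sum>n\<in>{M<..N}. zterm k \<sigma> n) \<le> T"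
    and "H + T < zterm k \<sigma> M"
  shows "(deriv ^^ k) zeta (Complex \<sigma> t) \<noteq> 0"
proof -
  define f :: "nat \<Rightarrow> complex" where
    "f = (\<lambda>n. (- of_real (ln (real n))) ^ k * of_nat n powr (- Complex \<sigma> t))"
  have norm_f: "norm (f n) = zterm k \<sigma> n" if "n \<ge> 1" for n
  proof -
    have "norm ((of_nat n :: complex) powr (- Complex \<sigma> t)) = real n powr (- \<sigma>)"
      using that by (subst norm_powr_real_powr) auto
    thus ?thesis using that by (simp add: f_def zterm_def norm_mult norm_power)
  qed
  have sum_norm_f: "(\<Sum>n\<in>A. norm (f n)) = (\<Sum>n\<in>A. zterm k \<sigma> n)" if "A \<subseteq> {1..}" for A
    using that by (intro sum.cong) (auto simp: norm_f)
  have "(\<lambda>n. f (Suc n)) sums (deriv ^^ k) zeta (Complex \<sigma> t)"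
    unfolding f_def using assms(1) by (intro higher_deriv_zeta_sums) simp
  thus ?thesis
  proof (rule sums_nonzero_if_dominant)
    show "(\<Sum>n\<in>{1..<M}. norm (f n)) \<le> H" using assms by (subst sum_norm_f) auto
    show "(\<Sum>n\<in>{M<..N}. norm (f n)) \<le> T" for N
      using assms by (subst sum_norm_f) auto
  qed (use assms norm_f in auto)
qed

section \<open>The range in which the third term dominates\<close>

lemma higher_deriv_zeta_nonzero_a:
  assumes lower: "zeta_q 3 * real k + 4 * ln 3 \<le> \<sigma>" and upper: "\<sigma> \<le> zeta_q 2 * real k - 2"
  shows "(deriv ^^ k) zeta (Complex \<sigma> t) \<noteq> 0"
proof -
  let ?Q = "zterm k \<sigma>"
  \<comment> \<open>For k = 0 the range would require 4 ln 3 \<le> - 2. Positivity of k removes the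
    term at n = 1.\<close>
  have "k > 0"
    using assms ln_3_ge by (cases "k = 0") auto
  have lower': "real k * zeta_q 3 + 35 / 8 \<le> \<sigma>"
    using lower ln_3_ge by (simp add: mult.commute)
  have "real k * zeta_q 3 \<ge> 0" using zeta_q_pos[of 3] by simp
  hence sigma: "\<sigma> > 1" using lower' by simp
  have Q3: "?Q 3 > 0" by (simp add: zterm_pos)
  have head: "(\<Sum>n\<in>{1..<3}. ?Q n) \<le> 4 / 9 * ?Q 3"
  proof -
    have "exp ((\<sigma> - real k * zeta_q 2) * (ln 3 - ln 2)) \<le> exp (- 2 * (ln 3 - ln (2::real)))"
      using upper by (simp only: exp_le_cancel_iff, intro mult_right_mono) (auto simp: mult.commute)
    also have "- 2 * (ln 3 - ln (2::real)) = 2 * ln (2 / 3)" by (simp add: ln_div)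
    also have "exp (2 * ln (2 / 3 :: real)) = 4 / 9"
      using exp_of_nat_mult[of 2 "ln (2 / 3 :: real)"] by (simp add: power2_eq_square)
    finally have "?Q 2 \<le> ?Q 3 * (4 / 9)"
      using zterm_Suc[of 2 k \<sigma>] Q3 by (simp add: eval_nat_numeral mult_left_mono)
    moreover have "{1..<3} = {Suc 0, 2}" by auto
    ultimately show ?thesis using zterm_1[OF \<open>k > 0\<close>, of \<sigma>] by simp
  qed
  \<comment> \<open>Eighth powers reduce the bounds to rational arithmetic; the 7 below encodes the
    exponent \<open>Suc 7\<close>.\<close>
  have root: "x powr (35 / 8) \<le> b" if "x ^ 35 \<le> b ^ 8" "x > 0" "b \<ge> 0" for x b :: real
  proof -
    have "(x powr (35 / 8)) ^ 8 = x ^ 35"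
      using that by (simp add: powr_power powr_numeral)
    thus ?thesis using that power_le_imp_le_base[of "x powr (35 / 8)" 7 b] by simp
  qed
  have p4: "(3 / 4 :: real) powr (35 / 8) \<le> 569 / 2000"
    by (rule root) (simp_all add: power_divide)
  have p5: "(3 / 5 :: real) powr (35 / 8) \<le> 134 / 1250"
    by (rule root) (simp_all add: power_divide)
  \<comment> \<open>Using \<open>zterm_tail_le\<close> from n = 4 would give about 0.62 Q 3, above 5
    / 9. So n = 4 is estimated by itself, and the integral comparison is used only beyond n =
    5.\<close>
  have tail: "(\<Sum>n\<in>{3<..N}. ?Q n) \<le> 551 / 1000 * ?Q 3" for N
  proof -
    have "(\<Sum>n\<in>{3<..N}. ?Q n) \<le> ?Q 4 + (\<Sum>n\<in>{5..N}. ?Q n)"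
    proof -
      have "(\<Sum>n\<in>{3<..N}. ?Q n) \<le> (\<Sum>n\<in>insert 4 {5..N}. ?Q n)"
        by (intro sum_mono2) (auto simp: zterm_nonneg)
      thus ?thesis by simp
    qed
    also have "?Q 4 \<le> ?Q 3 * (3 / 4) powr (35 / 8)"
      using zterm_le_powr[of 3 4 k "35 / 8" \<sigma>] lower' by simp
    also have "\<dots> \<le> ?Q 3 * (569 / 2000)"
      using Q3 p4 by (intro mult_left_mono) auto
    also have "(\<Sum>n\<in>{5..N}. ?Q n) \<le> ?Q 3 * ((3 / 5) powr (35 / 8) * (1 + 5 / (35 / 8 - 1)))"
      using zterm_tail_le[of 3 5 k "35 / 8" \<sigma> N] lower' by simp
    also have "\<dots> \<le> ?Q 3 * (134 / 1250 * (1 + 5 / (35 / 8 - 1)))"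
      using Q3 p5 by (intro mult_left_mono mult_right_mono) auto
    finally show ?thesis using Q3 by simp
  qed
  show ?thesis
    by (rule higher_deriv_zeta_nonzero[OF sigma _ head tail]) (use Q3 in auto)
qed

section \<open>The ranges in which the term at a general M dominates\<close>

lemma higher_deriv_zeta_nonzero_b:
  assumes M: "M \<ge> 3"
    and lower: "zeta_q M * real k + real (M + 1) * ln 3 \<le> \<sigma>"
    and upper: "\<sigma> \<le> zeta_q (M - 1) * real k - real M * ln 3"
  shows "(deriv ^^ k) zeta (Complex \<sigma> t) \<noteq> 0"
proof -
  let ?Q = "zterm k \<sigma>"
  define L where "L = ln (3::real)"
  have L: "L \<ge> 35 / 32" using ln_3_ge by (simp add: L_def)
  define a where "a = (real M + 1) * L"
  have a: "a > 4"
  proof -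
    have "4 * (35 / 32) \<le> a" unfolding a_def using M L by (intro mult_mono) auto
    thus ?thesis by simp
  qed
  have lower': "real k * zeta_q M + a \<le> \<sigma>"
    using lower by (simp add: a_def L_def algebra_simps)
  have upper': "\<sigma> \<le> real k * zeta_q (M - 1) - real M * L"
    using upper by (simp add: L_def algebra_simps)
  have "real k * zeta_q M \<ge> 0" using zeta_q_pos[of M] M by simp
  hence sigma: "\<sigma> > 1" using lower' a by simp
  have M_L_pos: "real M * L > 0" using M L by simp
  have gap: "real k * (zeta_q (M - 1) - zeta_q M) \<ge> (2 * real M + 1) * L"
    using lower' upper' by (simp add: a_def algebra_simps)
  have "k > 0"
    using lower' upper' a M_L_pos by (cases "k = 0") auto
  have QM: "?Q M > 0" using M by (simp add: zterm_pos)
  have head: "(\<Sum>n\<in>{1..<M}. ?Q n) \<le> 9 / 26 * ?Q M"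
  proof -
    have "?Q (M - 1) \<le> exp (- L) * ?Q (Suc (M - 1))"
      using M upper' L by (intro zterm_le_exp_mult_zterm_Suc) (auto simp: algebra_simps of_nat_diff)
    hence last: "?Q (M - 1) \<le> ?Q M / 3"
      using M by (simp add: L_def exp_minus)
    have step: "?Q n \<le> 1 / 27 * ?Q (Suc n)" if n: "1 \<le> n" "n < M - 1" for n
    proof (cases "n = 1")
      case True
      thus ?thesis using zterm_1[OF \<open>k > 0\<close>] by (simp add: zterm_nonneg)
    next
      case False
      hence n2: "n \<ge> 2" using n by simp
      have "zeta_q (M - 2) \<le> zeta_q n" using n n2 by (intro zeta_q_antimono) auto
      moreover have "2 * zeta_q (M - 1) \<le> zeta_q (M - 2) + zeta_q M"
      proof -
        have "Suc (M - 2) = M - 1" "Suc (M - 1) = M" using n n2 by auto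
        thus ?thesis using zeta_q_convex[of "M - 2"] n n2 by simp
      qed
      \<comment> \<open>So \<open>gap\<close> also bounds k (\<open>zeta_q n\<close> -
        \<open>zeta_q (M - 1)\<close>) from below. Together with M L from \<open>upper'\<close> this
        exceeds 3 M L, which gives the ratio exp (- 3 L) = 1 / 27.\<close>
      ultimately have "zeta_q (M - 1) - zeta_q M \<le> zeta_q n - zeta_q (M - 1)" by linarith
      hence "real k * (zeta_q (M - 1) - zeta_q M) \<le> real k * (zeta_q n - zeta_q (M - 1))"
        by (intro mult_left_mono) auto
      with gap upper' have "\<sigma> - real k * zeta_q n \<le> - (real M * L) - (2 * real M + 1) * L"
        by (simp add: algebra_simps)
      also have "\<dots> \<le> - (3 * L) * real M" using L by (simp add: algebra_simps)
      also have "\<dots> \<le> - (3 * L) * (real n + 1)" using n L by (intro mult_left_mono_neg) auto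
      finally have "?Q n \<le> exp (- (3 * L)) * ?Q (Suc n)"
        using n2 L by (intro zterm_le_exp_mult_zterm_Suc) auto
      moreover have "exp (- (3 * L)) = 1 / 27"
        using exp_of_nat_mult[of 3 L] by (simp add: L_def exp_minus field_simps)
      ultimately show ?thesis by simp
    qed
    \<comment> \<open>The geometric factor 27 / 26 times the 1 / 3 from \<open>last\<close> is 9 /
      26.\<close>
    have "(1 - 1 / 27) * (\<Sum>n\<in>{1..M - 1}. ?Q n) \<le> ?Q (M - 1)"
      using M step by (intro geometric_sum_le) (auto simp: zterm_nonneg)
    moreover have "{1..M - 1} = {1..<M}" using M by auto
    ultimately show ?thesis using last by simp
  qed
  \<comment> \<open>Since a = L / x, the bounds after M become functions of x alone, with M \<ge> 3
    entering only as x \<le> 1 / 4.\<close>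
  define x where "x = 1 / (real M + 1)"
  have x: "0 < x" "x \<le> 1 / 4" using M by (auto simp: x_def field_simps)
  have first: "(real M / (real M + 1)) powr a \<le> 1 / (3 * (1 + 35 / 64 * x))"
  proof -
    have "- ln (1 - x) \<ge> x + x ^ 2 / 2"
      using x ln_one_minus_le[of x] by simp
    hence "a * (x + x ^ 2 / 2) \<le> a * (- ln (1 - x))" using a by (intro mult_left_mono) auto
    also have "a * (x + x ^ 2 / 2) = ((real M + 1) * x) * (L + L * x / 2)"
      by (simp add: a_def algebra_simps power2_eq_square)
    also have "(real M + 1) * x = 1" by (simp add: x_def)
    also have "1 - x = real M / (real M + 1)" by (simp add: x_def field_simps)
    finally have "(real M / (real M + 1)) powr a \<le> exp (- (L + L * x / 2))"
      using M by (simp add: powr_def)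
    also have "\<dots> = 1 / (3 * exp (L * x / 2))"
    proof -
      have "exp L = 3" by (simp add: L_def)
      thus ?thesis by (simp only: exp_minus exp_add divide_inverse mult_1)
    qed
    also have "\<dots> \<le> 1 / (3 * (1 + 35 / 64 * x))"
    proof -
      have "1 + 35 / 64 * x \<le> 1 + L * x / 2" using L x by simp
      also have "\<dots> \<le> exp (L * x / 2)" by (rule exp_ge_add_one_self)
      finally show ?thesis using x by (intro divide_left_mono) auto
    qed
    finally show ?thesis .
  qed
  have rest: "1 + (real M + 1) / (a - 1) \<le> 1 + 1 / (35 / 32 - x)"
  proof -
    have "(real M + 1) / (a - 1) = 1 / (L - x)"
      using a M by (simp add: a_def x_def field_simps)
    also have "\<dots> \<le> 1 / (35 / 32 - x)"
      using x L by (intro divide_left_mono) auto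
    finally show ?thesis by simp
  qed
  define \<theta> where "\<theta> = 1 / (3 * (1 + 35 / 64 * x)) * (1 + 1 / (35 / 32 - x))"
  \<comment> \<open>Here 17 / 26 = 1 - 9 / 26 is what the earlier terms leave over. Cleared of
    denominators the claim is quadratic in x, and x * x \<le> x / 4 makes it linear.\<close>
  have \<theta>: "\<theta> < 17 / 26"
  proof -
    define y where "y = x * x"
    have sq: "y \<le> 1 / 4 * x" unfolding y_def using x by (intro mult_right_mono) auto
    have expand: "(1 + 35 / 64 * x) * (35 / 32 - x) = 35 / 32 - 823 / 2048 * x - 35 / 64 * y"
      by (simp add: y_def field_simps)
    have "26 * (67 / 32 - x) < 51 * ((1 + 35 / 64 * x) * (35 / 32 - x))"
      unfolding expand using sq x by simp
    moreover have "\<theta> = (67 / 32 - x) / (3 * ((1 + 35 / 64 * x) * (35 / 32 - x)))"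
      using x unfolding \<theta>_def by (simp add: divide_simps) (simp add: algebra_simps)
    ultimately show ?thesis using x by (simp add: divide_less_eq)
  qed
  have tail: "(\<Sum>n\<in>{M<..N}. ?Q n) \<le> ?Q M * \<theta>" for N
  proof -
    have "{M<..N} = {M + 1..N}" by auto
    hence "(\<Sum>n\<in>{M<..N}. ?Q n) \<le>
        ?Q M * ((real M / (real M + 1)) powr a * (1 + (real M + 1) / (a - 1)))"
      using zterm_tail_le[of M "M + 1" k a \<sigma> N] M lower' a by (simp add: add_ac)
    also have "\<dots> \<le> ?Q M * \<theta>"
      unfolding \<theta>_def using QM first rest a x by (intro mult_left_mono mult_mono) auto
    finally show ?thesis .
  qed
  have "9 / 26 * ?Q M + ?Q M * \<theta> < ?Q M"
    using mult_strict_left_mono[OF \<theta> QM] by simp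
  thus ?thesis
    by (intro higher_deriv_zeta_nonzero[OF sigma _ head tail]) (use M in auto)
qed

theorem theorem1:
  fixes k :: nat and \<sigma> t :: real
  shows "(zeta_q 3 * real k + 4 * ln 3 \<le> \<sigma> \<and> \<sigma> \<le> zeta_q 2 * real k - 2 \<longrightarrow>
            (deriv ^^ k) zeta (Complex \<sigma> t) \<noteq> 0) \<and>
         (\<forall>M::nat. M \<ge> 3 \<and>
            zeta_q M * real k + real (M + 1) * ln 3 \<le> \<sigma> \<and>
            \<sigma> \<le> zeta_q (M - 1) * real k - real M * ln 3 \<longrightarrow>
            (deriv ^^ k) zeta (Complex \<sigma> t) \<noteq> 0)"
  using higher_deriv_zeta_nonzero_a higher_deriv_zeta_nonzero_b by blast

end
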